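(* Let $H$ be a sparse semigroup of genus $g\ge 3$ with Frobenius number $\ell_g=2g-3$. Then $H$ is one of the following: (1) $H=3\mathbb{N}+H_5$, and $H$ is $2$-hyperelliptic; (2) $H=3\mathbb{N}+H_7$, and $H$ is $2$-hyperelliptic; (3) $H=2(\mathbb{N}\setminus\{1\})\cup H_{2g-2}$, and $H$ is $1$-hyperelliptic.
   Context: $\mathbb{N}$ is the set of natural numbers including $0$. A numerical semigroup $H\subseteq\mathbb{N}$ of genus $g\ge 1$ is a subset containing $0$, closed under addition, whose complement $\mathbb{N}\setminus H=\{1=\ell_1<\ell_2<\dots<\ell_g\}$ has exactly $g$ elements, called gaps; $\ell_g$ is the Frobenius number. $H$ is sparse if $\ell_i-\ell_{i-1}\le 2$ for all $i=2,\dots,g$. A numerical semigroup is $\gamma$-hyperelliptic if it has exactly $\gamma$ even gaps. For $n\in\mathbb{N}$, $H_n:=\{0,n+1,n+2,\dots\}$; $m\mathbb{N}+H_n:=\{ma+h: a\in\mathbb{N},\,h\in H_n\}$; for $A\subseteq\mathbb{N}$, $2A:=\{2a:a\in A\}$. *)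

theory Defs
  imports Main
begin

definition gaps :: "nat set \<Rightarrow> nat set" where
  "gaps H = UNIV - H"

definition genus :: "nat set \<Rightarrow> nat" where
  "genus H = card (gaps H)"

definition numerical_semigroup :: "nat set \<Rightarrow> bool" where
  "numerical_semigroup H \<longleftrightarrow>
     0 \<in> H \<and> (\<forall>a\<in>H. \<forall>b\<in>H. a + b \<in> H) \<and> finite (gaps H) \<and> genus H \<ge> 1"

text \<open>The \<open>i\<close>-th gap in increasing order, numbered from 1; meaningful for \<open>1 \<le> i \<le> genus H\<close>.\<close>

definition gap :: "nat set \<Rightarrow> nat \<Rightarrow> nat" where
  "gap H i = sorted_list_of_set (gaps H) ! (i - 1)"

definition frobenius_number :: "nat set \<Rightarrow> nat" where
  "frobenius_number H = gap H (genus H)"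

text \<open>Gaps are listed increasingly, so the natural-number subtraction below does not truncate.\<close>

definition sparse_semigroup :: "nat set \<Rightarrow> bool" where
  "sparse_semigroup H \<longleftrightarrow>
     numerical_semigroup H \<and> (\<forall>i\<in>{2..genus H}. gap H i - gap H (i - 1) \<le> 2)"

definition hyperelliptic :: "nat \<Rightarrow> nat set \<Rightarrow> bool" where
  "hyperelliptic \<gamma> H \<longleftrightarrow> numerical_semigroup H \<and> card {l \<in> gaps H. even l} = \<gamma>"

text \<open>\<open>H\<^sub>n = {0, n + 1, n + 2, \<dots>}\<close>\<close>

definition ordinary :: "nat \<Rightarrow> nat set" where
  "ordinary n = insert 0 {n + 1..}"

text \<open>\<open>m\<nat> + H\<^sub>n\<close>\<close>

definition multiples_plus_ordinary :: "nat \<Rightarrow> nat \<Rightarrow> nat set" where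
  "multiples_plus_ordinary m n = {m * a + h | a h. h \<in> ordinary n}"

definition double :: "nat set \<Rightarrow> nat set" where
  "double A = {2 * a | a. a \<in> A}"

end

theory Submission
  imports Defs
begin

text \<open>
  Sparseness says that two consecutive positive numbers up to the Frobenius number \<open>F = 2g - 3\<close> are
  never both in \<open>H\<close>. Pairing up the numbers below \<open>F\<close> this gives \<open>g - 1\<close> gaps, one less than the
  genus, so at most \<open>j + 1\<close> gaps lie in \<open>{1..2j}\<close> whenever \<open>2j + 1 \<le> F\<close>. The number 2 is a gap, as
  otherwise all gaps are odd and there are too few. The pair 1, 2 thus uses up the spare gap.
  If 3 is a gap, this forces the even numbers from 4 on into \<open>H\<close>. If 3 is in \<open>H\<close>, then
  \<open>F \<noteq> 9\<close>, and if \<open>F \<ge> 11\<close>, the neighbours of 3, 6 and 9 together with 1 are too many gaps.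
\<close>

lemma gap_iff [simp]: "x \<in> gaps H \<longleftrightarrow> x \<notin> H"
  by (simp add: gaps_def)

lemma numerical_semigroup_mult:
  assumes "numerical_semigroup H" "a \<in> H"
  shows "k * a \<in> H"
  by (induction k) (use assms in \<open>auto simp: numerical_semigroup_def\<close>)

lemma numerical_semigroup_one_gap:
  assumes "numerical_semigroup H"
  shows "1 \<notin> H"
proof
  assume "1 \<in> H"
  then have "n \<in> H" for n
    using numerical_semigroup_mult[OF assms, of 1 n] by simp
  then have "gaps H = {}" by auto
  with assms show False
    by (simp add: numerical_semigroup_def genus_def)
qed

lemma numerical_semigroup_frobenius:
  assumes "numerical_semigroup H"
  shows "frobenius_number H \<notin> H" and "\<And>x. x \<notin> H \<Longrightarrow> x \<le> frobenius_number H"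
proof -
  define xs where "xs = sorted_list_of_set (gaps H)"
  have xs: "set xs = gaps H" "sorted xs" "length xs = genus H" "genus H \<ge> 1"
    using assms by (auto simp: xs_def numerical_semigroup_def genus_def)
  have F: "frobenius_number H = xs ! (genus H - 1)"
    by (simp add: frobenius_number_def gap_def xs_def)
  show "frobenius_number H \<notin> H"
    unfolding F using xs nth_mem[of "genus H - 1" xs] by auto
  fix x assume "x \<notin> H"
  then obtain i where "i < length xs" "x = xs ! i"
    using xs(1) by (metis gap_iff in_set_conv_nth)
  then show "x \<le> frobenius_number H"
    unfolding F using xs by (auto intro: sorted_nth_mono)
qed

text \<open>A step of at most 2 in the list of gaps cannot jump over two consecutive members of
  \<open>H\<close>. Since the list starts below \<open>n\<close>, it would never get past
  \<open>n\<close>, contrary to \<open>n < frobenius_number H\<close>.\<close>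

lemma sparse_semigroup_no_consecutive:
  assumes "sparse_semigroup H" "n \<in> H" "1 \<le> n" "n < frobenius_number H"
  shows "Suc n \<notin> H"
proof
  assume "Suc n \<in> H"
  define xs where "xs = sorted_list_of_set (gaps H)"
  have H: "numerical_semigroup H"
    using assms by (simp add: sparse_semigroup_def)
  have xs: "set xs = gaps H" "sorted xs" "length xs = genus H" "genus H \<ge> 1"
    using H by (auto simp: xs_def numerical_semigroup_def genus_def)
  have diff: "xs ! Suc i - xs ! i \<le> 2" if "Suc i < genus H" for i
  proof -
    \<comment> \<open>\<open>gap\<close> counts from 1 and the list from 0, so
      \<open>gap H (i + 2)\<close> is \<open>xs ! Suc i\<close>.\<close>
    have "i + 2 \<in> {2..genus H}" using that by simp
    then have "gap H (i + 2) - gap H (i + 2 - 1) \<le> 2"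
      using assms(1) unfolding sparse_semigroup_def by blast
    then show ?thesis by (simp add: gap_def xs_def)
  qed
  have below: "i < genus H \<Longrightarrow> xs ! i < n" for i
  proof (induction i)
    case 0
    obtain j where "j < length xs" "xs ! j = 1"
      using xs(1) numerical_semigroup_one_gap[OF H] by (metis gap_iff in_set_conv_nth)
    then have "xs ! 0 \<le> 1" using sorted_nth_mono[OF xs(2), of 0 j] by simp
    moreover have "xs ! 0 \<notin> H" using xs 0 nth_mem[of 0 xs] by auto
    ultimately show ?case
      using \<open>1 \<le> n\<close> \<open>n \<in> H\<close> by (metis le_trans order_le_imp_less_or_eq)
  next
    case (Suc i)
    have "xs ! Suc i \<notin> H" using xs Suc nth_mem[of "Suc i" xs] by auto
    then have "xs ! Suc i \<noteq> n" "xs ! Suc i \<noteq> Suc n"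
      using \<open>n \<in> H\<close> \<open>Suc n \<in> H\<close> by auto
    then show ?case using diff[OF Suc.prems] Suc by simp
  qed
  have "frobenius_number H = xs ! (genus H - 1)"
    by (simp add: frobenius_number_def gap_def xs_def)
  with below[of "genus H - 1"] xs(4) assms(4) show False by simp
qed

text \<open>The \<open>2 * k\<close> numbers from \<open>a\<close> on split into \<open>k\<close>
  pairs of neighbours, each containing a gap. The last pair may end at the Frobenius number itself,
  hence the bound with \<open>Suc\<close>.\<close>

lemma sparse_semigroup_gap_count:
  assumes "sparse_semigroup H" "1 \<le> a" "a + 2 * k \<le> Suc (frobenius_number H)"
  shows "card (gaps H \<inter> {..<a}) + k \<le> card (gaps H \<inter> {..<a + 2 * k})"
  using assms(3)
proof (induction k)
  case (Suc k)
  let ?n = "a + 2 * k"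
  have "?n \<notin> H \<or> Suc ?n \<notin> H"
    using sparse_semigroup_no_consecutive[OF assms(1), of ?n] assms(2) Suc.prems by auto
  then obtain x where x: "x \<notin> H" "?n \<le> x" "x < ?n + 2"
    by (metis Suc_n_not_le_n add_2_eq_Suc' le_SucI lessI less_SucI order_refl)
  have "Suc (card (gaps H \<inter> {..<?n})) = card (insert x (gaps H \<inter> {..<?n}))"
    using x by (subst card_insert_disjoint) auto
  also have "\<dots> \<le> card (gaps H \<inter> {..<?n + 2})"
    using x by (intro card_mono) auto
  finally show ?case using Suc by (simp add: add.assoc)
qed simp

text \<open>From \<open>2 * j + 1\<close> up to just below the Frobenius number there are
  \<open>genus H - 2 - j\<close> pairs, each with a gap, and the Frobenius number is one more.
  Removing these from all gaps leaves at most \<open>j + 1\<close>.\<close>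

lemma sparse_semigroup_few_gaps_below:
  assumes "sparse_semigroup H" "frobenius_number H = 2 * genus H - 3" "genus H \<ge> 2"
    and "2 * j + 1 \<le> frobenius_number H"
  shows "card (gaps H \<inter> {..<2 * j + 1}) \<le> j + 1"
proof -
  let ?F = "frobenius_number H"
  have H: "numerical_semigroup H" using assms(1) by (simp add: sparse_semigroup_def)
  have F: "?F = 2 * j + 1 + 2 * (genus H - 2 - j)" "j \<le> genus H - 2"
    using assms by auto
  have "card (gaps H \<inter> {..<2 * j + 1}) + (genus H - 2 - j) \<le> card (gaps H \<inter> {..<?F})"
    using sparse_semigroup_gap_count[OF assms(1), of "2 * j + 1" "genus H - 2 - j"] F by simp
  also have "\<dots> < card (insert ?F (gaps H \<inter> {..<?F}))"
    by (subst card_insert_disjoint) auto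
  also have "\<dots> \<le> genus H"
    unfolding genus_def using H numerical_semigroup_frobenius(1)[OF H]
    by (intro card_mono) (auto simp: numerical_semigroup_def)
  finally show ?thesis using F(2) assms(3) by linarith
qed

text \<open>The summand from \<open>ordinary n\<close> is either 0, leaving a multiple of
  \<open>m\<close>, or exceeds \<open>n\<close>, and so does the sum. For concrete \<open>m\<close>
  and \<open>n\<close> this makes membership a Presburger condition.\<close>

lemma mem_multiples_plus_ordinary:
  "x \<in> multiples_plus_ordinary m n \<longleftrightarrow> m dvd x \<or> n < x"
proof
  assume "x \<in> multiples_plus_ordinary m n"
  then show "m dvd x \<or> n < x"
    by (auto simp: multiples_plus_ordinary_def ordinary_def)
next
  assume "m dvd x \<or> n < x"
  then show "x \<in> multiples_plus_ordinary m n"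
  proof
    assume "m dvd x"
    then obtain a where "x = m * a + 0" by (auto elim: dvdE)
    then show ?thesis unfolding multiples_plus_ordinary_def ordinary_def by blast
  next
    assume "n < x"
    then have "x = m * 0 + x" "x \<in> ordinary n" by (auto simp: ordinary_def)
    then show ?thesis unfolding multiples_plus_ordinary_def by blast
  qed
qed

lemma gaps_eq_iff: "gaps H = gaps K \<longleftrightarrow> H = K"
  by (auto simp: gaps_def)

lemma gaps_multiples_of_three:
  "gaps (multiples_plus_ordinary 3 5) = {1, 2, 4, 5}"
  "gaps (multiples_plus_ordinary 3 7) = {1, 2, 4, 5, 7}"
proof -
  have "x \<notin> multiples_plus_ordinary 3 5 \<longleftrightarrow> x \<in> {1, 2, 4, 5}"
    and "x \<notin> multiples_plus_ordinary 3 7 \<longleftrightarrow> x \<in> {1, 2, 4, 5, 7}" for x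
    unfolding mem_multiples_plus_ordinary insert_iff empty_iff by presburger+
  then show "gaps (multiples_plus_ordinary 3 5) = {1, 2, 4, 5}"
    "gaps (multiples_plus_ordinary 3 7) = {1, 2, 4, 5, 7}"
    by (auto simp: gaps_def)
qed

lemma mem_double: "x \<in> double A \<longleftrightarrow> even x \<and> x div 2 \<in> A"
  by (auto simp: double_def elim!: evenE)

theorem theorem2p6:
  fixes H :: "nat set" and g :: nat
  assumes "sparse_semigroup H"
    and "genus H = g"
    and "g \<ge> 3"
    and "frobenius_number H = 2 * g - 3"
  shows "(H = multiples_plus_ordinary 3 5 \<and> hyperelliptic 2 H)
       \<or> (H = multiples_plus_ordinary 3 7 \<and> hyperelliptic 2 H)
       \<or> (H = double (UNIV - {1}) \<union> ordinary (2 * g - 2) \<and> hyperelliptic 1 H)"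
proof -
  let ?F = "frobenius_number H"
  have H: "numerical_semigroup H" using assms(1) by (simp add: sparse_semigroup_def)
  have zero: "0 \<in> H" using H by (simp add: numerical_semigroup_def)
  have one: "1 \<notin> H" by (rule numerical_semigroup_one_gap[OF H])
  note mult = numerical_semigroup_mult[OF H]
  have F: "?F \<notin> H" by (rule numerical_semigroup_frobenius[OF H])
  have above: "x \<in> H" if "?F < x" for x
    using numerical_semigroup_frobenius(2)[OF H, of x] that by linarith
  have nonconsec: "Suc n \<notin> H" if "n \<in> H" "1 \<le> n" "n < ?F" for n
    using sparse_semigroup_no_consecutive[OF assms(1)] that by blast
  have few: "card (gaps H \<inter> {..<2 * j + 1}) \<le> j + 1" if "2 * j + 1 \<le> ?F" for j
    using sparse_semigroup_few_gaps_below[OF assms(1) _ _ that] assms by simp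
  have two: "2 \<notin> H"
  proof
    assume "2 \<in> H"
    \<comment> \<open>All gaps would be odd and at most 2(g - 2) + 1, which leaves room for only g -
      1 of them.\<close>
    have "gaps H \<subseteq> (\<lambda>k. 2 * k + 1) ` {..<g - 1}"
    proof
      fix x assume x: "x \<in> gaps H"
      then have "odd x" using mult[OF \<open>2 \<in> H\<close>] by (auto elim!: evenE simp: mult.commute)
      moreover have "x \<le> 2 * g - 3" using above[of x] x assms(4) by force
      ultimately show "x \<in> (\<lambda>k. 2 * k + 1) ` {..<g - 1}"
        by (auto elim!: oddE)
    qed
    then have "card (gaps H) \<le> g - 1"
      using surj_card_le[of "{..<g - 1}"] by fastforce
    then show False using assms by (simp add: genus_def)
  qed
  show ?thesis
  proof (cases "3 \<in> H")
    case True
    have six: "6 \<in> H" and nine: "9 \<in> H" using mult[OF True, of 2] mult[OF True, of 3] by auto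
    have "?F \<noteq> 3" "?F \<noteq> 9" using F True nine by metis+
    moreover have "odd ?F" using assms(3,4) by simp
    ultimately have "?F = 5 \<or> ?F = 7 \<or> 11 \<le> ?F" using assms(3,4) by presburger
    then have "gaps H = {1, 2, 4, 5} \<or> gaps H = {1, 2, 4, 5, 7}"
    proof (elim disjE)
      assume F5: "?F = 5"
      have "x \<in> {1, 2, 4, 5}" if "x \<notin> H" for x
      proof -
        have "x \<le> 5" "x \<noteq> 0" "x \<noteq> 3"
          using above[of x] that F5 zero True by (force, metis+)
        then show ?thesis by auto
      qed
      moreover have "4 \<notin> H" "5 \<notin> H" using nonconsec[OF True] F F5 by auto
      ultimately have "gaps H = {1, 2, 4, 5}" using one two by (intro set_eqI) auto
      then show ?thesis by simp
    next
      assume F7: "?F = 7"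
      have "x \<in> {1, 2, 4, 5, 7}" if "x \<notin> H" for x
      proof -
        have "x \<le> 7" "x \<noteq> 0" "x \<noteq> 3" "x \<noteq> 6"
          using above[of x] that F7 zero True six by (force, metis+)
        then show ?thesis by auto
      qed
      moreover have "4 \<notin> H" "5 \<notin> H" "7 \<notin> H"
        using nonconsec[OF True] nonconsec[of 5] six F F7 by auto
      ultimately have "gaps H = {1, 2, 4, 5, 7}" using one two by (intro set_eqI) auto
      then show ?thesis by simp
    next
      assume F11: "11 \<le> ?F"
      have "4 \<notin> H" "5 \<notin> H" "7 \<notin> H" "8 \<notin> H" "10 \<notin> H"
        using nonconsec[OF True] nonconsec[of 5] nonconsec[OF six] nonconsec[of 8]
          nonconsec[OF nine] six nine F11 by auto
      \<comment> \<open>These are seven gaps, whereas \<open>few\<close> at \<open>j = 5\<close>,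
        available because \<open>?F\<close> is at least 11, allows only six.\<close>
      then have "{1, 2, 4, 5, 7, 8, 10} \<subseteq> gaps H \<inter> {..<2 * 5 + 1}"
        using one two by auto
      then have "card {1, 2, 4, 5, 7, 8, 10 :: nat} \<le> card (gaps H \<inter> {..<2 * 5 + 1})"
        by (rule card_mono[rotated]) simp
      also have "\<dots> \<le> 5 + 1" using few[of 5] F11 by simp
      finally show ?thesis by simp
    qed
    moreover have "{l \<in> {1, 2, 4, 5 :: nat}. even l} = {2, 4}"
      "{l \<in> {1, 2, 4, 5, 7 :: nat}. even l} = {2, 4}" by auto
    \<comment> \<open>The explicit lists are folded back into gap sets of the two semigroups, so
      that equal gap sets yield equal semigroups.\<close>
    ultimately show ?thesis
      using H unfolding hyperelliptic_def gaps_multiples_of_three[symmetric] gaps_eq_iff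
      by (auto simp: gaps_multiples_of_three simp del: gap_iff)
  next
    case False
    have even: "2 * k \<in> H" if "2 \<le> k" for k
    proof (rule ccontr)
      assume gap: "2 * k \<notin> H"
      then have "2 * k \<le> ?F" using above[of "2 * k"] by linarith
      moreover have "odd ?F" using assms(3,4) by simp
      \<comment> \<open>Parity gives the extra 1 that \<open>few\<close> needs at
        \<open>j = k\<close>. The gaps 1, 2, 3 and one from each of the \<open>k - 2\<close> pairs
        between 4 and \<open>2 * k - 1\<close> make \<open>k + 1\<close>; the gap
        \<open>2 * k\<close> is then one too many.\<close>
      ultimately have k: "2 * k + 1 \<le> ?F" by presburger
      have "4 + 2 * (k - 2) = 2 * k" using that by simp
      moreover have "card {1, 2, 3 :: nat} \<le> card (gaps H \<inter> {..<4})"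
        using one two False by (intro card_mono) auto
      ultimately have "k + 1 \<le> card (gaps H \<inter> {..<2 * k})"
        using sparse_semigroup_gap_count[OF assms(1), of 4 "k - 2"] that k by simp
      also have "\<dots> < card (insert (2 * k) (gaps H \<inter> {..<2 * k}))"
        by (subst card_insert_disjoint) auto
      also have "\<dots> \<le> card (gaps H \<inter> {..<2 * k + 1})"
        using gap by (intro card_mono) auto
      also have "\<dots> \<le> k + 1" using few k by blast
      finally show False by simp
    qed
    \<comment> \<open>From 5 on, the even predecessor is in \<open>H\<close> and excludes its
      successor; 1 and 3 are gaps already.\<close>
    have odd: "2 * k + 1 \<notin> H" if "2 * k + 1 \<le> ?F" for k
    proof (cases "2 \<le> k")
      case True
      then show ?thesis using nonconsec[OF even[OF True]] that by simp
    next
      case False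
      then have "k = 0 \<or> k = 1" by auto
      then show ?thesis using one \<open>3 \<notin> H\<close> by auto
    qed
    have mem: "x \<in> H \<longleftrightarrow> x \<noteq> 2 \<and> (even x \<or> ?F < x)" for x
    proof (cases "even x")
      case True
      then obtain k where k: "x = 2 * k" by (rule evenE)
      then show ?thesis using even[of k] zero two by (cases "k = 0 \<or> k = 1") auto
    next
      case False
      then obtain k where k: "x = 2 * k + 1" by (rule oddE)
      then show ?thesis using odd[of k] above[of x] by (auto simp: not_less[symmetric])
    qed
    have "H = double (UNIV - {1}) \<union> ordinary (2 * g - 2)"
    proof (intro set_eqI)
      fix x
      \<comment> \<open>The thresholds \<open>?F\<close> and \<open>2 * g - 2\<close> differ by one,
        but the number between them, 2g - 2, is even and at least 4, so it lies in the doubled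
        part.\<close>
      show "x \<in> H \<longleftrightarrow> x \<in> double (UNIV - {1}) \<union> ordinary (2 * g - 2)"
        using assms(3) by (simp add: mem assms(4) mem_double ordinary_def) presburger
    qed
    moreover have "{l \<in> gaps H. even l} = {2}" by (auto simp: mem)
    ultimately show ?thesis using H by (simp add: hyperelliptic_def)
  qed
qed

end
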